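(* Let $K$ be an algebraically closed field of characteristic different from $2$, $g>1$ an integer, $\alpha_1,\dots,\alpha_{2g+1}$ distinct elements of $K$, $\mathcal{C}$ the smooth projective model of $y^2=\prod_{i=1}^{2g+1}(x-\alpha_i)$, and $J$ its jacobian, with $\mathcal{C}$ embedded in $J$ so that $\infty\mapsto 0$. Let $m$ be an integer such that $3\le m\le 2g$. Then $\mathcal{C}(K)$ does not contain a point of order $m$ in $J(K)$. In particular, $\mathcal{C}(K)$ does not contain points of order $3$ or $4$.
   Context: The curve $\mathcal{C}$ is a genus $g$ hyperelliptic curve with exactly one point at infinity, denoted $\infty$. A point $P\in\mathcal{C}(K)$ is identified with the linear equivalence class $\mathrm{cl}((P)-(\infty))\in J(K)$. *)

theory Defs
  imports
    "HOL-Computational_Algebra.Computational_Algebra"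
    "HOL-Algebra.Algebraic_Closure_Type"
    "HOL-Algebra.Free_Abelian_Groups"
    "HOL-Algebra.Multiplicative_Group"
begin

section \<open>The hyperelliptic curve and its points\<close>

definition hyp_poly :: "nat \<Rightarrow> (nat \<Rightarrow> 'a::field) \<Rightarrow> 'a poly" where
  "hyp_poly g \<alpha> = (\<Prod>i\<in>{1..2 * g + 1}. [:- \<alpha> i, 1:])"

text \<open>
  Let \<open>f\<close> have degree \<open>2g + 1\<close>.  The smooth projective model of \<open>y\<^sup>2 = f(x)\<close> is glued from
  the affine curve \<open>y\<^sup>2 = f(x)\<close> and the affine curve \<open>w\<^sup>2 = z\<^bsup>2g+2\<^esup> f(1/z)\<close> along
  \<open>z = 1/x\<close>, \<open>w = y/x\<^bsup>g+1\<^esup>\<close>.  The polynomial \<open>z\<^bsup>2g+2\<^esup> f(1/z)\<close> vanishes at \<open>z = 0\<close>, so the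
  only point of the second chart that is not in the first one is \<open>(z, w) = (0, 0)\<close>.
\<close>

datatype 'a point = Affine 'a 'a | Infinity

definition curve :: "'a::field poly \<Rightarrow> 'a point set" where
  "curve f = {Affine a b | a b. b\<^sup>2 = poly f a} \<union> {Infinity}"


section \<open>The function field\<close>

text \<open>
  The function field \<open>K(x, y)\<close> is realised as a subfield of an algebraic closure of the
  rational function field \<open>K(x)\<close>.
\<close>

type_synonym 'a fun_closure = "'a poly fract alg_closure"

definition const :: "'a::field \<Rightarrow> 'a fun_closure" where
  "const c = to_ac (to_fract [:c:])"

definition fun_x :: "'a::field fun_closure" where
  "fun_x = to_ac (to_fract [:0, 1:])"

text \<open>Replacing this square root by its negative is the same as applying the hyperelliptic
  involution, which changes neither the function field nor the set of points.\<close>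

definition fun_y :: "'a::field poly \<Rightarrow> 'a fun_closure" where
  "fun_y f = (SOME y. y\<^sup>2 = to_ac (to_fract f))"

lemma fun_y_squared: "(fun_y f)\<^sup>2 = to_ac (to_fract f)"
  unfolding fun_y_def by (rule someI_ex, rule nth_root_exists) simp

text \<open>A bivariate polynomial \<open>p(S, T)\<close> over \<open>K\<close> is encoded as an element of \<open>K[S][T]\<close>.
  Its coefficients are transported along \<open>h\<close> before it is evaluated at \<open>S = s\<close>, \<open>T = t\<close>.\<close>

definition eval2 :: "('a::field \<Rightarrow> 'b::field) \<Rightarrow> 'a poly poly \<Rightarrow> 'b \<Rightarrow> 'b \<Rightarrow> 'b" where
  "eval2 h p s t = poly (map_poly (\<lambda>r. poly (map_poly h r) s) p) t"

definition function_field :: "'a::field poly \<Rightarrow> 'a fun_closure set" where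
  "function_field f =
     {eval2 const p fun_x (fun_y f) / eval2 const q fun_x (fun_y f) | p q.
        eval2 const q fun_x (fun_y f) \<noteq> 0}"


section \<open>Local rings and orders of vanishing\<close>

text \<open>
  The local ring, and its maximal ideal, at the point with coordinates \<open>(a, b)\<close> in the affine
  chart whose coordinate functions are \<open>s\<close> and \<open>t\<close>.  When \<open>(a, b)\<close> lies on that chart,
  \<open>q(a, b) \<noteq> 0\<close> implies \<open>q(s, t) \<noteq> 0\<close>.
\<close>

definition chart_ring ::
    "'a::field fun_closure \<Rightarrow> 'a fun_closure \<Rightarrow> 'a \<Rightarrow> 'a \<Rightarrow> 'a fun_closure set" where
  "chart_ring s t a b =
     {eval2 const p s t / eval2 const q s t | p q. eval2 id q a b \<noteq> 0}"

definition chart_ideal ::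
    "'a::field fun_closure \<Rightarrow> 'a fun_closure \<Rightarrow> 'a \<Rightarrow> 'a \<Rightarrow> 'a fun_closure set" where
  "chart_ideal s t a b =
     {eval2 const p s t / eval2 const q s t | p q. eval2 id q a b \<noteq> 0 \<and> eval2 id p a b = 0}"

fun local_ring :: "nat \<Rightarrow> 'a::field poly \<Rightarrow> 'a point \<Rightarrow> 'a fun_closure set" where
  "local_ring g f (Affine a b) = chart_ring fun_x (fun_y f) a b"
| "local_ring g f Infinity = chart_ring (1 / fun_x) (fun_y f / fun_x ^ (g + 1)) 0 0"

fun max_ideal :: "nat \<Rightarrow> 'a::field poly \<Rightarrow> 'a point \<Rightarrow> 'a fun_closure set" where
  "max_ideal g f (Affine a b) = chart_ideal fun_x (fun_y f) a b"
| "max_ideal g f Infinity = chart_ideal (1 / fun_x) (fun_y f / fun_x ^ (g + 1)) 0 0"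

definition uniformizer :: "nat \<Rightarrow> 'a::field poly \<Rightarrow> 'a point \<Rightarrow> 'a fun_closure \<Rightarrow> bool" where
  "uniformizer g f P \<pi> \<longleftrightarrow> max_ideal g f P = (\<lambda>u. \<pi> * u) ` local_ring g f P"

text \<open>For a smooth curve the local ring at \<open>P\<close> is a discrete valuation ring, so every nonzero
  rational function is uniquely a unit times an integral power of any given uniformizer, and
  the exponent does not depend on the uniformizer.\<close>

definition ord_at :: "nat \<Rightarrow> 'a::field poly \<Rightarrow> 'a point \<Rightarrow> 'a fun_closure \<Rightarrow> int" where
  "ord_at g f P \<phi> =
     (THE n. \<exists>\<pi> u. uniformizer g f P \<pi> \<and> u \<in> local_ring g f P - max_ideal g f P \<and>
                   \<phi> = u * \<pi> powi n)"


section \<open>Divisors and the Jacobian\<close>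

abbreviation divisor_group :: "'a::field poly \<Rightarrow> ('a point \<Rightarrow>\<^sub>0 int) monoid" where
  "divisor_group f \<equiv> free_Abelian_group (curve f)"

definition divisor_degree :: "('a point \<Rightarrow>\<^sub>0 int) \<Rightarrow> int" where
  "divisor_degree D = (\<Sum>P\<in>Poly_Mapping.keys D. Poly_Mapping.lookup D P)"

definition principal_divisors :: "nat \<Rightarrow> 'a::field poly \<Rightarrow> ('a point \<Rightarrow>\<^sub>0 int) set" where
  "principal_divisors g f =
     {D \<in> carrier (divisor_group f).
        \<exists>\<phi> \<in> function_field f - {0}. \<forall>P \<in> curve f. Poly_Mapping.lookup D P = ord_at g f P \<phi>}"

definition Pic :: "nat \<Rightarrow> 'a::field poly \<Rightarrow> ('a point \<Rightarrow>\<^sub>0 int) set monoid" where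
  "Pic g f = divisor_group f Mod principal_divisors g f"

definition divisor_class :: "nat \<Rightarrow> 'a::field poly \<Rightarrow> ('a point \<Rightarrow>\<^sub>0 int) \<Rightarrow> ('a point \<Rightarrow>\<^sub>0 int) set"
  where "divisor_class g f D = principal_divisors g f #>\<^bsub>divisor_group f\<^esub> D"

text \<open>Over an algebraically closed field \<open>K\<close>, the group \<open>J(K)\<close> is the group of linear
  equivalence classes of divisors of degree zero.\<close>

definition Jacobian :: "nat \<Rightarrow> 'a::field poly \<Rightarrow> ('a point \<Rightarrow>\<^sub>0 int) set monoid" where
  "Jacobian g f = (Pic g f)
     \<lparr>carrier := divisor_class g f ` {D \<in> carrier (divisor_group f). divisor_degree D = 0}\<rparr>"

definition point_class :: "nat \<Rightarrow> 'a::field poly \<Rightarrow> 'a point \<Rightarrow> ('a point \<Rightarrow>\<^sub>0 int) set" where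
  "point_class g f P =
     divisor_class g f (Poly_Mapping.single P 1 - Poly_Mapping.single Infinity 1)"

end

theory Submission
  imports Defs
begin

text \<open>
  Let \<open>P = (a, b)\<close> and suppose \<open>m (P - \<infinity>)\<close> is the divisor of a function \<open>\<phi>\<close>.  Having no poles on the
  affine curve, \<open>\<phi>\<close> is \<open>A(x) + B(x) y\<close> for polynomials \<open>A\<close> and \<open>B\<close>.  At infinity \<open>A(x)\<close> has a pole of
  the even order \<open>2 deg A\<close> and \<open>B(x) y\<close> one of the odd order \<open>2 deg B + 2g + 1\<close>, so no cancellation
  is possible and \<open>m \<le> 2g\<close> forces \<open>B = 0\<close>.  Then \<open>\<phi> = A(x)\<close> vanishes at \<open>(a, -b)\<close> as well as at
  \<open>(a, b)\<close>, whence \<open>b = 0\<close>; but then \<open>x - a\<close> has divisor \<open>2 (P - \<infinity>)\<close>, and the order of \<open>P\<close>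
  divides \<open>2\<close>.
\<close>

section \<open>Discrete valuation rings inside a field\<close>

text \<open>The formula of \<open>ord_at\<close>, freed from the curve: the local ring and its
  maximal ideal become parameters.\<close>

definition valuation :: "'b::field set \<Rightarrow> 'b set \<Rightarrow> 'b \<Rightarrow> int" where
  "valuation R M \<phi> =
     (THE n. \<exists>\<pi> u. M = (\<lambda>u. \<pi> * u) ` R \<and> u \<in> R - M \<and> \<phi> = u * \<pi> powi n)"

text \<open>The ambient field will be an algebraic closure, much larger than the function field, so
  no axiom writes every nonzero element as a unit times a power of \<pi>. For the elements that
  matter this is proved separately, as membership in some \<open>frac n\<close>. The axiom
  \<open>inverse_pi\<close> says that \<pi> is not a unit.\<close>

locale discrete_valuation =
  fixes R M :: "'b::field set" and \<pi> :: 'b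
  assumes one_closed: "1 \<in> R"
    and add_closed: "x \<in> R \<Longrightarrow> y \<in> R \<Longrightarrow> x + y \<in> R"
    and mult_closed: "x \<in> R \<Longrightarrow> y \<in> R \<Longrightarrow> x * y \<in> R"
    and pi_nonzero: "\<pi> \<noteq> 0"
    and pi_closed: "\<pi> \<in> R"
    and inverse_pi: "inverse \<pi> \<notin> R"
    and ideal_eq: "M = (\<lambda>u. \<pi> * u) ` R"
    and inverse_closed: "x \<in> R \<Longrightarrow> x \<notin> M \<Longrightarrow> inverse x \<in> R"
    and uminus_closed: "x \<in> R \<Longrightarrow> - x \<in> R"
begin

definition units :: "'b set" where "units = {u \<in> R. u \<noteq> 0 \<and> inverse u \<in> R}"

text \<open>The elements of valuation exactly \<open>n\<close>.\<close>

definition frac :: "int \<Rightarrow> 'b set" where "frac n = {u * \<pi> powi n | u. u \<in> units}"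

text \<open>A unit of the form \<open>\<pi> * r\<close> would put \<open>inverse \<pi>\<close> into
  \<open>R\<close>. Zero has to be excluded from \<open>R - M\<close> by hand, because
  \<open>units\<close> asks for nonzero elements.\<close>

lemma units_eq: "units = R - M"
proof -
  have "u \<notin> M" if "u \<in> units" for u
  proof
    assume "u \<in> M"
    then obtain r where r: "r \<in> R" "u = \<pi> * r"
      using ideal_eq by auto
    then have "inverse \<pi> = r * inverse u"
      using that pi_nonzero by (auto simp: units_def field_simps)
    moreover have "r * inverse u \<in> R"
      using r that mult_closed by (simp add: units_def)
    ultimately show False
      using inverse_pi by simp
  qed
  moreover have "0 \<in> R"
    using add_closed[OF one_closed uminus_closed[OF one_closed]] by simp
  then have "0 \<in> M"
    using ideal_eq by force
  ultimately show ?thesis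
    using inverse_closed by (auto simp: units_def)
qed

lemma units_mult: "u \<in> units \<Longrightarrow> v \<in> units \<Longrightarrow> u * v \<in> units"
  by (auto simp: units_def mult_closed)

lemma units_inverse: "u \<in> units \<Longrightarrow> inverse u \<in> units"
  by (auto simp: units_def)

lemma one_units: "1 \<in> units"
  by (auto simp: units_def one_closed)

lemma pi_power_closed: "n \<ge> 0 \<Longrightarrow> \<pi> powi n \<in> R"
proof -
  have "\<pi> ^ k \<in> R" for k
    by (induction k) (auto simp: one_closed mult_closed pi_closed)
  then show "n \<ge> 0 \<Longrightarrow> \<pi> powi n \<in> R"
    by (simp add: power_int_def)
qed

lemma frac_nonzero: "\<phi> \<in> frac n \<Longrightarrow> \<phi> \<noteq> 0"
  using pi_nonzero by (auto simp: frac_def units_def)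

lemma frac_mult: "\<phi> \<in> frac m \<Longrightarrow> \<psi> \<in> frac n \<Longrightarrow> \<phi> * \<psi> \<in> frac (m + n)"
proof -
  assume "\<phi> \<in> frac m" "\<psi> \<in> frac n"
  then obtain u v where "u \<in> units" "v \<in> units" "\<phi> = u * \<pi> powi m" "\<psi> = v * \<pi> powi n"
    by (auto simp: frac_def)
  then have "\<phi> * \<psi> = (u * v) * \<pi> powi (m + n)" "u * v \<in> units"
    using pi_nonzero units_mult by (auto simp: power_int_add)
  then show ?thesis
    unfolding frac_def by blast
qed

lemma frac_inverse: "\<phi> \<in> frac m \<Longrightarrow> inverse \<phi> \<in> frac (- m)"
  using units_inverse by (fastforce simp: frac_def power_int_minus)

lemma frac_divide: "\<phi> \<in> frac m \<Longrightarrow> \<psi> \<in> frac n \<Longrightarrow> \<phi> / \<psi> \<in> frac (m - n)"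
  using frac_mult[OF _ frac_inverse, of \<phi> m \<psi> n] by (simp add: divide_inverse)

lemma frac_0_eq: "frac 0 = units"
  by (auto simp: frac_def)

lemma pi_frac: "\<pi> \<in> frac 1"
  using one_units by (force simp: frac_def)

lemma frac_power: "\<phi> \<in> frac m \<Longrightarrow> \<phi> ^ k \<in> frac (int k * m)"
proof (induction k)
  case 0
  then show ?case
    using one_units by (simp add: frac_0_eq)
next
  case (Suc k)
  then show ?case
    using frac_mult[of \<phi> m "\<phi> ^ k" "int k * m"] by (simp add: algebra_simps)
qed

lemma frac_closed: "\<phi> \<in> frac n \<Longrightarrow> n \<ge> 0 \<Longrightarrow> \<phi> \<in> R"
  using pi_power_closed mult_closed by (auto simp: frac_def units_def)

text \<open>Dividing by \<pi> lowers a positive valuation by one, so the quotient is still in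
  \<open>R\<close>. Conversely, an element of \<open>M\<close> with \<open>n \<le> 0\<close> would
  have its inverse in \<open>R\<close> and be a unit.\<close>

lemma frac_pos_iff:
  assumes "\<phi> \<in> frac n"
  shows "\<phi> \<in> M \<longleftrightarrow> n > 0"
proof
  assume "n > 0"
  then have "inverse \<pi> * \<phi> \<in> R"
    using frac_mult[OF frac_inverse[OF pi_frac] assms] frac_closed by auto
  moreover have "\<phi> = \<pi> * (inverse \<pi> * \<phi>)"
    using pi_nonzero by simp
  ultimately show "\<phi> \<in> M"
    using ideal_eq by blast
next
  assume "\<phi> \<in> M"
  show "n > 0"
  proof (rule ccontr)
    assume n: "\<not> n > 0"
    have "inverse \<phi> \<in> R"
      using frac_closed[OF frac_inverse[OF assms]] n by simp
    moreover have "\<phi> \<in> R"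
      using \<open>\<phi> \<in> M\<close> ideal_eq pi_closed mult_closed by auto
    ultimately have "\<phi> \<in> units"
      using frac_nonzero[OF assms] by (simp add: units_def)
    then show False
      using \<open>\<phi> \<in> M\<close> units_eq by auto
  qed
qed

text \<open>The quotient of \<phi> by itself is 1, which lies in \<open>frac (m - n)\<close> but not
  in \<open>M\<close>; hence \<open>m \<le> n\<close>, and the roles can be exchanged.\<close>

lemma frac_unique: "\<phi> \<in> frac m \<Longrightarrow> \<phi> \<in> frac n \<Longrightarrow> m = n"
proof -
  have "m \<le> n" if "\<phi> \<in> frac m" "\<phi> \<in> frac n" for m n
  proof -
    have "1 \<in> frac (m - n)"
      using frac_divide[OF that] frac_nonzero[OF that(1)] by simp
    moreover have "1 \<notin> M"
      using one_units units_eq by auto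
    ultimately show ?thesis
      using frac_pos_iff by force
  qed
  then show "\<phi> \<in> frac m \<Longrightarrow> \<phi> \<in> frac n \<Longrightarrow> m = n"
    by (metis order_antisym)
qed

text \<open>Two generators of \<open>M\<close> divide each other, so they differ by a unit. This is
  needed because \<open>valuation\<close> quantifies over all generators.\<close>

lemma uniformizer_frac:
  assumes "M = (\<lambda>u. \<rho> * u) ` R"
  shows "\<rho> \<in> frac 1"
proof -
  have "\<pi> \<in> M"
    using ideal_eq one_closed by force
  then obtain r where r: "r \<in> R" "\<pi> = \<rho> * r"
    using assms by auto
  have "\<rho> \<in> M"
    using assms one_closed by force
  then obtain q where q: "q \<in> R" "\<rho> = \<pi> * q"
    using ideal_eq by auto
  have "q * r = 1"
    using r q pi_nonzero by auto
  then have "q \<in> units"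
    using r q by (auto simp: units_def inverse_unique)
  then show ?thesis
    using q by (force simp: frac_def)
qed

lemma valuation_eq: 
  assumes "\<phi> \<in> frac n"
  shows "valuation R M \<phi> = n"
  unfolding valuation_def
proof (rule the_equality)
  show "\<exists>\<pi> u. M = (*) \<pi> ` R \<and> u \<in> R - M \<and> \<phi> = u * \<pi> powi n"
    using assms ideal_eq units_eq by (auto simp: frac_def)
next
  fix k
  assume "\<exists>\<pi> u. M = (*) \<pi> ` R \<and> u \<in> R - M \<and> \<phi> = u * \<pi> powi k"
  then obtain \<rho> u where \<rho>: "M = (*) \<rho> ` R" "u \<in> units" "\<phi> = u * \<rho> powi k"
    using units_eq by auto
  \<comment> \<open>Any other generator \<rho> has valuation 1, so its powers have the same
    valuations as those of \<pi>. The case split is there because \<open>frac_power\<close> treats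
    natural exponents only.\<close>
  have "\<rho> powi k \<in> frac k"
  proof (cases "k \<ge> 0")
    case True
    then show ?thesis
      using frac_power[OF uniformizer_frac[OF \<rho>(1)], of "nat k"] by (simp add: power_int_def)
  next
    case False
    then show ?thesis
      using frac_power[OF frac_inverse[OF uniformizer_frac[OF \<rho>(1)]], of "nat (- k)"]
      by (simp add: power_int_def)
  qed
  then have "\<phi> \<in> frac k"
    using frac_mult[of u 0] \<rho> frac_0_eq by auto
  then show "k = n"
    using assms frac_unique by blast
qed

lemma unit_add_ideal:
  assumes "u \<in> units" and "x \<in> M"
  shows "u + x \<in> units"
proof -
  obtain q where q: "q \<in> R" "x = \<pi> * q"
    using assms ideal_eq by auto
  have "u + x \<notin> M"
  proof
    assume "u + x \<in> M"
    then obtain p where p: "p \<in> R" "u + x = \<pi> * p"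
      using ideal_eq by auto
    then have "u = \<pi> * (p + - q)"
      using q by (simp add: algebra_simps)
    then have "u \<in> M"
      using ideal_eq add_closed uminus_closed p q by blast
    then show False
      using assms units_eq by auto
  qed
  then show ?thesis
    using assms q add_closed mult_closed pi_closed units_eq by auto
qed

text \<open>Write the sum as \<open>\<phi> * (1 + \<psi> / \<phi>)\<close>; the quotient lies in
  \<open>M\<close>, so the second factor is a unit.\<close>

lemma frac_add:
  assumes "\<phi> \<in> frac m" and "\<psi> \<in> frac n" and "m < n"
  shows "\<phi> + \<psi> \<in> frac m"
proof -
  have "\<psi> / \<phi> \<in> M"
    using frac_divide[OF assms(2,1)] frac_pos_iff assms(3) by auto
  then have "1 + \<psi> / \<phi> \<in> frac 0"
    using unit_add_ideal one_units frac_0_eq by auto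
  then show ?thesis
    using frac_mult[OF assms(1)] frac_nonzero[OF assms(1)] by (fastforce simp: algebra_simps)
qed

end

section \<open>Polynomials in the coordinate functions\<close>

definition ev :: "'a::field fun_closure \<Rightarrow> 'a poly \<Rightarrow> 'a fun_closure" where
  "ev s p = poly (map_poly const p) s"

lemma const_hom [simp]:
  "const 0 = 0" "const 1 = 1" "const (c + d) = const c + const d" "const (c * d) = const c * const d"
  by (simp_all add: const_def flip: to_fract_add to_ac_add to_ac_mult to_fract_mult one_pCons)

lemma const_uminus [simp]: "const (- c) = - const c"
  using const_hom(3)[of c "- c"] by (simp add: eq_neg_iff_add_eq_0 add.commute)

lemma const_eq_0_iff [simp]: "const c = 0 \<longleftrightarrow> c = 0"
  by (simp add: const_def)

lemma ev_0 [simp]: "ev s 0 = 0"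
  by (simp add: ev_def)

lemma ev_pCons [simp]: "ev s (pCons c p) = const c + s * ev s p"
  by (simp add: ev_def map_poly_pCons)

lemma ev_1 [simp]: "ev s 1 = 1"
  by (simp add: one_pCons del: one_pCons[symmetric])

lemma ev_add [simp]: "ev s (p + q) = ev s p + ev s q"
  by (induction p q rule: poly_induct2) (simp_all add: algebra_simps)

lemma ev_uminus [simp]: "ev s (- p) = - ev s p"
  using ev_add[of s p "- p"] by (simp add: eq_neg_iff_add_eq_0 add.commute del: ev_add)

lemma ev_diff [simp]: "ev s (p - q) = ev s p - ev s q"
  using ev_add[of s p "- q"] by simp

lemma ev_smult [simp]: "ev s (smult c p) = const c * ev s p"
  by (induction p) (simp_all add: algebra_simps)

lemma ev_mult [simp]: "ev s (p * q) = ev s p * ev s q"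
  by (induction p) (simp_all add: algebra_simps)

lemma ev_power [simp]: "ev s (p ^ n) = ev s p ^ n"
  by (induction n) simp_all

text \<open>Yields the injectivity of \<open>ev fun_x\<close>, as both embeddings on the right are
  injective.\<close>

lemma ev_fun_x: "ev fun_x p = to_ac (to_fract p)"
proof (induction p)
  case (pCons c p)
  have "pCons c p = [:c:] + [:0, 1:] * p"
    by simp
  then show ?case
    using pCons by (metis const_def ev_pCons fun_x_def to_ac_add to_ac_mult to_fract_add to_fract_mult)
qed simp

lemma degree_map_poly_const [simp]: "degree (map_poly const p) = degree p"
  by (rule degree_map_poly) simp

text \<open>Reversing the coefficients exchanges \<open>s\<close> and \<open>1 / s\<close>; this is
  the passage between the two charts.\<close>

lemma ev_reflect_poly:
  assumes "s \<noteq> 0"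
  shows "ev s (reflect_poly p) = s ^ degree p * ev (1 / s) p"
proof -
  have "map_poly const (reflect_poly p) = reflect_poly (map_poly const p)"
    by (rule poly_eqI) (simp add: coeff_map_poly coeff_reflect_poly)
  then show ?thesis
    using assms by (simp add: ev_def poly_reflect_poly_nz divide_inverse)
qed

text \<open>The normal form of a polynomial in \<open>s\<close> and \<open>t\<close> modulo a
  relation that expresses the square of \<open>t\<close> as a polynomial in \<open>s\<close>;
  \<open>val2\<close> is the value of the same expression at a point.\<close>

definition elt :: "'a::field fun_closure \<Rightarrow> 'a fun_closure \<Rightarrow> 'a poly \<Rightarrow> 'a poly \<Rightarrow> 'a fun_closure" where
  "elt s t A B = ev s A + ev s B * t"

definition val2 :: "'a::field \<Rightarrow> 'a \<Rightarrow> 'a poly \<Rightarrow> 'a poly \<Rightarrow> 'a" where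
  "val2 a b A B = poly A a + poly B a * b"

lemma eval2_const_pCons: "eval2 const (pCons c p) s t = ev s c + t * eval2 const p s t"
  by (simp add: eval2_def map_poly_pCons flip: ev_def)

lemma eval2_id_pCons: "eval2 id (pCons c p) a b = poly c a + b * eval2 id p a b"
  by (simp add: eval2_def map_poly_pCons)

lemma eval2_0 [simp]: "eval2 f 0 s t = 0"
  by (simp add: eval2_def)

lemma eval2_elt: "eval2 const [:A, B:] s t = elt s t A B" "eval2 id [:A, B:] a b = val2 a b A B"
  by (simp_all add: eval2_const_pCons eval2_id_pCons elt_def val2_def)

text \<open>Horner's rule in \<open>t\<close>: if \<open>p\<close> reduces to A + B t, then c + t p
  reduces to (c + B h) + A t. The same \<open>A\<close> and \<open>B\<close> serve for the function
  and for its values at all points of the curve.\<close>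

lemma eval2_reduce:
  assumes "t\<^sup>2 = ev s h"
  obtains A B where "eval2 const p s t = elt s t A B"
    "\<And>a b. b\<^sup>2 = poly h a \<Longrightarrow> eval2 id p a b = val2 a b A B"
proof -
  have "\<exists>A B. eval2 const p s t = elt s t A B \<and>
      (\<forall>a b. b\<^sup>2 = poly h a \<longrightarrow> eval2 id p a b = val2 a b A B)"
  proof (induction p)
    case 0
    have "eval2 const 0 s t = elt s t 0 0" "\<And>a b. eval2 id 0 a b = val2 a b 0 0"
      by (simp_all add: elt_def val2_def)
    then show ?case
      by blast
  next
    case (pCons c p)
    then obtain A B where "eval2 const p s t = elt s t A B"
      "\<And>a b. b\<^sup>2 = poly h a \<Longrightarrow> eval2 id p a b = val2 a b A B"
      by blast
    then have "eval2 const (pCons c p) s t = elt s t (c + B * h) A"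
      "\<And>a b. b\<^sup>2 = poly h a \<Longrightarrow> eval2 id (pCons c p) a b = val2 a b (c + B * h) A"
      using assms
      by (auto simp: eval2_const_pCons eval2_id_pCons elt_def val2_def algebra_simps power2_eq_square
          simp flip: assms)
    then show ?case
      by blast
  qed
  then show thesis
    using that by blast
qed

section \<open>Double covers of the line\<close>

text \<open>Covers both charts of the curve. The first assumption makes \<open>s\<close>
  transcendental over the constants, and the simple root keeps \<open>h\<close> from being a square
  in K(s).\<close>

locale double_cover =
  fixes s t :: "'a::field fun_closure" and h :: "'a poly"
  assumes ev_eq_0: "ev s p = 0 \<Longrightarrow> p = 0"
    and t_squared: "t\<^sup>2 = ev s h"
    and h_nonzero: "h \<noteq> 0"
    and simple_root: "\<exists>e. order e h = 1"
begin

text \<open>At the simple root of \<open>h\<close> the left side has even order and the right side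
  odd order, unless both vanish.\<close>

lemma norm_nonzero:
  assumes "A\<^sup>2 = B\<^sup>2 * h"
  shows "A = 0 \<and> B = 0"
proof (rule ccontr)
  assume neq: "\<not> (A = 0 \<and> B = 0)"
  obtain e where e: "order e h = 1"
    using simple_root by blast
  have "A \<noteq> 0" "B \<noteq> 0"
    using neq assms h_nonzero by auto
  then have "order e (A * A) = order e (B * B * h)" "A * A \<noteq> 0" "B * B * h \<noteq> 0"
    using assms h_nonzero by (auto simp: power2_eq_square)
  then have "2 * order e A = 2 * order e B + 1"
    using e by (simp add: order_mult)
  then show False
    by presburger
qed

text \<open>The product of a function with its image under the involution t -> -t is its norm down
  to K(s).\<close>

lemma conjugate: "elt s t A B * elt s t A (- B) = ev s (A\<^sup>2 - B\<^sup>2 * h)"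
  by (simp add: elt_def algebra_simps power2_eq_square flip: t_squared)

text \<open>1 and \<open>t\<close> are linearly independent over K(s), since an element that is zero
  has norm zero.\<close>

lemma elt_eq_0_iff: "elt s t A B = 0 \<longleftrightarrow> A = 0 \<and> B = 0"
proof
  assume "elt s t A B = 0"
  then have "A\<^sup>2 - B\<^sup>2 * h = 0"
    using conjugate ev_eq_0 by (metis mult_zero_left)
  then show "A = 0 \<and> B = 0"
    by (intro norm_nonzero) simp
qed (simp add: elt_def)

lemma elt_diff: "elt s t A B - elt s t C D = elt s t (A - C) (B - D)"
  by (simp add: elt_def algebra_simps)

lemma elt_eq_iff: "elt s t A B = elt s t C D \<longleftrightarrow> A = C \<and> B = D"
  using elt_eq_0_iff[of "A - C" "B - D"] elt_diff[of A B C D] by auto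

lemma elt_add: "elt s t A B + elt s t C D = elt s t (A + C) (B + D)"
  by (simp add: elt_def algebra_simps)

lemma elt_uminus: "- elt s t A B = elt s t (- A) (- B)"
  by (simp add: elt_def algebra_simps)

lemma elt_mult: "elt s t A B * elt s t C D = elt s t (A * C + B * D * h) (A * D + B * C)"
  by (simp add: elt_def algebra_simps power2_eq_square flip: t_squared)

end

section \<open>The local ring at a smooth point of a chart\<close>

locale smooth_chart = double_cover s t h for s t :: "'a::field fun_closure" and h :: "'a poly" +
  fixes a b :: 'a
  assumes two_nonzero: "(2::'a) \<noteq> 0"
    and on_curve: "b\<^sup>2 = poly h a"
    and smooth: "b = 0 \<Longrightarrow> order a h = 1"
begin

abbreviation R where "R \<equiv> chart_ring s t a b"
abbreviation M where "M \<equiv> chart_ideal s t a b"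

text \<open>If \<open>b\<close> is nonzero, the derivative 2b of t^2 - h(s) with respect to t does
  not vanish and s - a is a local parameter. If \<open>b = 0\<close>, the simple root of
  \<open>h\<close> at \<open>a\<close> makes the derivative with respect to s nonzero, and t is a
  local parameter.\<close>

definition \<pi> where "\<pi> = (if b = 0 then t else ev s [:- a, 1:])"

lemma R_eq: "R = {elt s t A B / elt s t C D | A B C D. val2 a b C D \<noteq> 0}"
proof (intro Set.set_eqI iffI)
  fix x assume "x \<in> R"
  then obtain p q where pq: "x = eval2 const p s t / eval2 const q s t" "eval2 id q a b \<noteq> 0"
    unfolding chart_ring_def by blast
  obtain A B where "eval2 const p s t = elt s t A B"
    using eval2_reduce[OF t_squared] by metis
  moreover obtain C D where "eval2 const q s t = elt s t C D" "eval2 id q a b = val2 a b C D"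
    using eval2_reduce[OF t_squared] on_curve by metis
  ultimately show "x \<in> {elt s t A B / elt s t C D | A B C D. val2 a b C D \<noteq> 0}"
    using pq by auto
next
  fix x assume "x \<in> {elt s t A B / elt s t C D | A B C D. val2 a b C D \<noteq> 0}"
  then show "x \<in> R"
    unfolding chart_ring_def by (smt (verit) eval2_elt mem_Collect_eq)
qed

lemma M_eq: "M = {elt s t A B / elt s t C D | A B C D. val2 a b C D \<noteq> 0 \<and> val2 a b A B = 0}"
proof (intro Set.set_eqI iffI)
  fix x assume "x \<in> M"
  then obtain p q where pq: "x = eval2 const p s t / eval2 const q s t" "eval2 id q a b \<noteq> 0"
      "eval2 id p a b = 0"
    unfolding chart_ideal_def by blast
  obtain A B where "eval2 const p s t = elt s t A B" "eval2 id p a b = val2 a b A B"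
    using eval2_reduce[OF t_squared] on_curve by metis
  moreover obtain C D where "eval2 const q s t = elt s t C D" "eval2 id q a b = val2 a b C D"
    using eval2_reduce[OF t_squared] on_curve by metis
  ultimately show "x \<in> {elt s t A B / elt s t C D | A B C D. val2 a b C D \<noteq> 0 \<and> val2 a b A B = 0}"
    using pq by auto
next
  fix x assume "x \<in> {elt s t A B / elt s t C D | A B C D. val2 a b C D \<noteq> 0 \<and> val2 a b A B = 0}"
  then show "x \<in> M"
    unfolding chart_ideal_def by (smt (verit) eval2_elt mem_Collect_eq)
qed

text \<open>The arguments on the left are the coefficients in \<open>elt_mult\<close>, so evaluation
  at the point respects products.\<close>

lemma val2_mult: "val2 a b (A * C + B * D * h) (A * D + B * C) = val2 a b A B * val2 a b C D"
  by (simp add: val2_def algebra_simps power2_eq_square flip: on_curve)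

lemma elt_nonzero: "val2 a b A B \<noteq> 0 \<Longrightarrow> elt s t A B \<noteq> 0"
  by (auto simp: elt_eq_0_iff val2_def)

lemma one_elt: "elt s t 1 0 = 1" "val2 a b 1 0 = 1"
  by (simp_all add: elt_def val2_def)

lemma RI: "val2 a b C D \<noteq> 0 \<Longrightarrow> elt s t A B / elt s t C D \<in> R"
  unfolding R_eq by blast

lemma MI: "val2 a b C D \<noteq> 0 \<Longrightarrow> val2 a b A B = 0 \<Longrightarrow> elt s t A B / elt s t C D \<in> M"
  unfolding M_eq by blast

lemma RE:
  assumes "x \<in> R"
  obtains A B C D where "x = elt s t A B / elt s t C D" "val2 a b C D \<noteq> 0" "elt s t C D \<noteq> 0"
  using assms elt_nonzero unfolding R_eq by blast

lemma elt_R: "elt s t A B \<in> R"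
  using RI[of 1 0 A B] by (simp add: one_elt)

text \<open>Membership in \<open>M\<close> only provides some fraction equal to the element.
  Clearing its denominator gives an equation between normal forms, whose coefficients are unique, so
  the values agree.\<close>

lemma elt_M_iff: "elt s t A B \<in> M \<longleftrightarrow> val2 a b A B = 0"
proof
  assume "elt s t A B \<in> M"
  then obtain C D E F where *: "elt s t A B = elt s t C D / elt s t E F" "val2 a b E F \<noteq> 0"
      "val2 a b C D = 0"
    unfolding M_eq by blast
  then have "elt s t A B * elt s t E F = elt s t C D"
    using elt_nonzero by simp
  then have "val2 a b A B * val2 a b E F = val2 a b C D"
    unfolding elt_mult elt_eq_iff val2_mult[symmetric] by simp
  then show "val2 a b A B = 0"
    using * by simp
next
  assume "val2 a b A B = 0"
  then show "elt s t A B \<in> M"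
    using MI[of 1 0 A B] by (simp add: one_elt)
qed

lemma R_mult: "x \<in> R \<Longrightarrow> y \<in> R \<Longrightarrow> x * y \<in> R"
proof -
  assume "x \<in> R" "y \<in> R"
  then obtain A B C D A' B' C' D' where
    "x = elt s t A B / elt s t C D" "val2 a b C D \<noteq> 0"
    "y = elt s t A' B' / elt s t C' D'" "val2 a b C' D' \<noteq> 0"
    by (metis RE)
  then show ?thesis
    using RI val2_mult by (simp add: elt_mult)
qed

lemma R_add: "x \<in> R \<Longrightarrow> y \<in> R \<Longrightarrow> x + y \<in> R"
proof -
  assume "x \<in> R" "y \<in> R"
  then obtain A B C D A' B' C' D' where
    "x = elt s t A B / elt s t C D" "val2 a b C D \<noteq> 0" "elt s t C D \<noteq> 0"
    "y = elt s t A' B' / elt s t C' D'" "val2 a b C' D' \<noteq> 0" "elt s t C' D' \<noteq> 0"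
    by (metis RE)
  then show ?thesis
    using RI val2_mult by (simp add: add_frac_eq elt_mult elt_add)
qed

lemma R_uminus: "x \<in> R \<Longrightarrow> - x \<in> R"
  by (metis RE RI elt_uminus minus_divide_left)

lemma R_inverse: "x \<in> R \<Longrightarrow> x \<notin> M \<Longrightarrow> inverse x \<in> R"
proof -
  assume "x \<in> R" "x \<notin> M"
  then obtain A B C D where "x = elt s t A B / elt s t C D" "val2 a b C D \<noteq> 0" "val2 a b A B \<noteq> 0"
    using MI by (metis RE)
  then show ?thesis
    using RI by simp
qed

lemma pi_cases: "b = 0 \<Longrightarrow> \<pi> = t" "b \<noteq> 0 \<Longrightarrow> \<pi> = ev s [:- a, 1:]"
  unfolding \<pi>_def by simp_all

lemma pi_in_M: "\<pi> \<in> M"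
proof (cases "b = 0")
  case True
  then have "elt s t 0 1 \<in> M"
    unfolding elt_M_iff by (simp add: val2_def)
  then show ?thesis
    by (simp add: pi_cases(1)[OF True] elt_def)
next
  case False
  then have "elt s t [:- a, 1:] 0 \<in> M"
    unfolding elt_M_iff by (simp add: val2_def)
  then show ?thesis
    by (simp add: pi_cases(2)[OF False] elt_def)
qed

lemma t_nonzero: "t \<noteq> 0"
  using elt_eq_0_iff[of 0 1] by (auto simp: elt_def)

lemma pi_nonzero: "\<pi> \<noteq> 0"
  using t_nonzero ev_eq_0[of "[:- a, 1:]"] by (auto simp: \<pi>_def simp del: ev_pCons)

lemma h_factor: 
  assumes "b = 0"
  obtains h' where "h = [:- a, 1:] * h'" "poly h' a \<noteq> 0"
proof -
  obtain h' where "h = [:- a, 1:] ^ order a h * h'" "\<not> [:- a, 1:] dvd h'"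
    using order_decomp[OF h_nonzero] by blast
  then show thesis
    using that smooth[OF assms] by (simp add: poly_eq_0_iff_dvd)
qed

text \<open>In each case, multiplication by a function that does not vanish at the point makes the
  factor \<pi> visible.\<close>

lemma elt_pi_multiple: 
  assumes "val2 a b A B = 0"
  shows "\<exists>r \<in> R. elt s t A B = \<pi> * r"
proof (cases "b = 0")
  case True
  obtain h' where h': "h = [:- a, 1:] * h'" "poly h' a \<noteq> 0"
    using h_factor[OF True] .
  have "poly A a = 0"
    using assms True by (simp add: val2_def)
  then obtain A' where A': "A = [:- a, 1:] * A'"
    unfolding poly_eq_0_iff_dvd by (auto elim: dvdE)
  have nz: "ev s h' \<noteq> 0"
    using ev_eq_0[of h'] h'(2) by auto
  \<comment> \<open>Here (s - a) h' is the square of t, so multiplying A = (s - a) A' by h' produces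
    a factor t in both summands.\<close>
  have "elt s t A B * ev s h' = \<pi> * elt s t (B * h') A'"
  proof -
    have "elt s t A B * ev s h' = ev s h * ev s A' + ev s B * ev s h' * t"
      unfolding elt_def A' h'(1) ev_mult by (simp add: algebra_simps)
    also have "\<dots> = \<pi> * elt s t (B * h') A'"
      by (simp add: pi_cases(1)[OF True] elt_def algebra_simps power2_eq_square flip: t_squared)
    finally show ?thesis .
  qed
  then have "elt s t A B = \<pi> * elt s t (B * h') A' / ev s h'"
    using nz by (simp add: nonzero_eq_divide_eq)
  moreover have "elt s t (B * h') A' / elt s t h' 0 \<in> R"
    using h'(2) by (intro RI) (simp add: val2_def)
  then have "elt s t (B * h') A' / ev s h' \<in> R"
    by (simp add: elt_def)
  ultimately show ?thesis
    by (metis times_divide_eq_right)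
next
  case False
  have "poly (A + smult b B) a = 0"
    using assms by (simp add: val2_def algebra_simps)
  then obtain A' where A': "A + smult b B = [:- a, 1:] * A'"
    unfolding poly_eq_0_iff_dvd by (auto elim: dvdE)
  have "poly (h - [:b\<^sup>2:]) a = 0"
    using on_curve by simp
  then obtain k where k: "h - [:b\<^sup>2:] = [:- a, 1:] * k"
    unfolding poly_eq_0_iff_dvd by (auto elim: dvdE)
  \<comment> \<open>The multiplier is t + b, with value 2b at the point. It turns B t into an
    expression in t^2 - b^2 = h - b^2, which is divisible by s - a.\<close>
  have v: "val2 a b [:b:] 1 \<noteq> 0"
    using False two_nonzero by (simp add: val2_def flip: mult_2)
  have "elt s t A B * elt s t [:b:] 1
      = ev s (A + smult b B) * (const b + t) + ev s B * (t\<^sup>2 - ev s [:b\<^sup>2:])"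
    by (simp add: elt_def algebra_simps power2_eq_square)
  also have "\<dots> = ev s (A + smult b B) * (const b + t) + ev s B * ev s (h - [:b\<^sup>2:])"
    by (simp add: t_squared)
  also have "\<dots> = \<pi> * elt s t (smult b A' + B * k) A'"
    unfolding A' k using False by (simp add: \<pi>_def elt_def algebra_simps)
  finally have "elt s t A B = \<pi> * elt s t (smult b A' + B * k) A' / elt s t [:b:] 1"
    using elt_nonzero[OF v] by (simp add: nonzero_eq_divide_eq)
  then show ?thesis
    using RI[OF v] by (metis times_divide_eq_right)
qed

lemma M_eq_pi: "M = (\<lambda>u. \<pi> * u) ` R"
proof (intro Set.set_eqI iffI)
  fix x assume "x \<in> M"
  then obtain A B C D where x: "x = elt s t A B / elt s t C D" "val2 a b C D \<noteq> 0" "val2 a b A B = 0"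
    unfolding M_eq by blast
  then obtain r where r: "r \<in> R" "elt s t A B = \<pi> * r"
    using elt_pi_multiple by blast
  have "1 / elt s t C D \<in> R"
    using RI[OF x(2), of 1 0] by (simp add: one_elt)
  then have "r * (1 / elt s t C D) \<in> R"
    using r R_mult by blast
  moreover have "x = \<pi> * (r * (1 / elt s t C D))"
    using x r by simp
  ultimately show "x \<in> (\<lambda>u. \<pi> * u) ` R"
    by blast
next
  fix x assume "x \<in> (\<lambda>u. \<pi> * u) ` R"
  then obtain r where r: "r \<in> R" "x = \<pi> * r"
    by blast
  obtain A B C D where 1: "r = elt s t A B / elt s t C D" "val2 a b C D \<noteq> 0"
    using r by (metis RE)
  obtain A' B' C' D' where 2: "\<pi> = elt s t A' B' / elt s t C' D'" "val2 a b C' D' \<noteq> 0"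
      "val2 a b A' B' = 0"
    using pi_in_M unfolding M_eq by blast
  show "x \<in> M"
    using 1 2 val2_mult by (simp add: r(2) elt_mult MI)
qed

sublocale dv: discrete_valuation R M \<pi>
proof
  show "inverse \<pi> \<notin> R"
  proof
    assume "inverse \<pi> \<in> R"
    then have "elt s t 1 0 \<in> M"
      using M_eq_pi pi_nonzero by (force simp: one_elt)
    then show False
      unfolding elt_M_iff by (simp add: one_elt)
  qed
  have "M \<subseteq> R"
    unfolding M_eq R_eq by blast
  then show "\<pi> \<in> R"
    using pi_in_M by blast
  show "1 \<in> R"
    using elt_R[of 1 0] by (simp add: one_elt)
qed (use R_add R_mult R_uminus R_inverse pi_nonzero M_eq_pi in auto)

section \<open>Valuations of polynomial functions at the point\<close>

lemma elt_units: "val2 a b A B \<noteq> 0 \<Longrightarrow> elt s t A B \<in> dv.frac 0"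
  using dv.units_eq elt_R elt_M_iff dv.frac_0_eq by blast

lemma ev_units: "poly A a \<noteq> 0 \<Longrightarrow> ev s A \<in> dv.frac 0"
  using elt_units[of A 0] by (simp add: elt_def val2_def)

text \<open>The projection to the s-line is ramified of index 2 where \<open>b = 0\<close>: there s
  - a is the square of t divided by a unit.\<close>

lemma ev_linear_frac: "ev s [:- a, 1:] \<in> dv.frac (if b = 0 then 2 else 1)"
proof (cases "b = 0")
  case True
  obtain h' where h': "h = [:- a, 1:] * h'" "poly h' a \<noteq> 0"
    using h_factor[OF True] .
  then have "ev s h' \<noteq> 0"
    using ev_eq_0[of h'] by auto
  then have "ev s [:- a, 1:] = \<pi>\<^sup>2 / ev s h'"
    by (simp add: pi_cases(1)[OF True] t_squared h'(1) del: ev_pCons mult_pCons_left)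
  then show ?thesis
    using True dv.frac_divide[OF dv.frac_power[OF dv.pi_frac, of 2] ev_units[OF h'(2)]]
    by (simp del: ev_pCons)
next
  case False
  then show ?thesis
    using dv.pi_frac by (simp add: \<pi>_def del: ev_pCons)
qed

lemma ev_frac:
  assumes "A \<noteq> 0"
  shows "ev s A \<in> dv.frac (int (order a A) * (if b = 0 then 2 else 1))"
proof -
  obtain A' where A': "A = [:- a, 1:] ^ order a A * A'" "\<not> [:- a, 1:] dvd A'"
    using order_decomp[OF assms] by blast
  have "ev s [:- a, 1:] ^ order a A * ev s A' \<in> dv.frac (int (order a A) * (if b = 0 then 2 else 1) + 0)"
    using A'(2) by (intro dv.frac_mult dv.frac_power ev_linear_frac ev_units) (simp add: poly_eq_0_iff_dvd)
  then show ?thesis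
    by (subst A'(1)) (simp del: ev_pCons)
qed

lemma frac_distinct_add:
  assumes "\<phi> \<in> dv.frac m" "\<psi> \<in> dv.frac n" "m \<noteq> n"
  shows "\<phi> + \<psi> \<in> dv.frac (min m n)"
proof (cases "m < n")
  case True
  then show ?thesis
    using dv.frac_add[OF assms(1,2)] by simp
next
  case False
  then show ?thesis
    using dv.frac_add[OF assms(2,1)] assms(3) by (simp add: add.commute min_def)
qed

text \<open>If \<open>b = 0\<close>, the two summands have even and odd valuation and cannot cancel.
  Otherwise induct on the degrees: a function with nonzero value is a unit; if \<open>B\<close> does
  not vanish at \<open>a\<close>, the conjugate is a unit and the norm is a polynomial in
  \<open>s\<close>; if \<open>A\<close> and \<open>B\<close> both vanish, split off s - a.\<close>

lemma elt_frac:
  assumes "A \<noteq> 0 \<or> B \<noteq> 0"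
  shows "\<exists>n. elt s t A B \<in> dv.frac n"
proof (cases "b = 0")
  case True
  have B: "ev s B * t \<in> dv.frac (int (order a B) * 2 + 1)" if "B \<noteq> 0"
    using dv.frac_mult[OF ev_frac[OF that] dv.pi_frac] by (simp only: pi_cases(1)[OF True] if_P[OF True])
  have A: "ev s A \<in> dv.frac (int (order a A) * 2)" if "A \<noteq> 0"
    using ev_frac[OF that] True by simp
  consider "A = 0" "B \<noteq> 0" | "B = 0" "A \<noteq> 0" | "A \<noteq> 0" "B \<noteq> 0"
    using assms by blast
  then show ?thesis
  proof cases
    case 3
    have "int (order a A) * 2 \<noteq> int (order a B) * 2 + 1"
      by presburger
    then show ?thesis
      using frac_distinct_add[OF A[OF 3(1)] B[OF 3(2)]] by (auto simp: elt_def)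
  qed (use A B in \<open>auto simp: elt_def\<close>)
next
  case False
  show ?thesis
    using assms
  proof (induction "degree A + degree B" arbitrary: A B rule: less_induct)
    case less
    consider "val2 a b A B \<noteq> 0" | "val2 a b A B = 0" "poly B a \<noteq> 0"
      | "poly A a = 0" "poly B a = 0"
      by (cases "poly B a = 0") (auto simp: val2_def)
    then show ?case
    proof cases
      case 1
      then show ?thesis
        using elt_units by blast
    next
      case 2
      \<comment> \<open>The values of the function and of its conjugate differ by 2 B(a) b.\<close>
      have "val2 a b A (- B) \<noteq> 0"
      proof -
        have "val2 a b A (- B) = val2 a b A B - 2 * (poly B a * b)"
          by (simp add: val2_def)
        then show ?thesis
          using 2 two_nonzero False by simp
      qed
      then have u: "elt s t A (- B) \<in> dv.frac 0"
        by (rule elt_units)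
      have "A\<^sup>2 - B\<^sup>2 * h \<noteq> 0"
        using norm_nonzero less.prems by auto
      then obtain n where "elt s t A B * elt s t A (- B) \<in> dv.frac n"
        unfolding conjugate using ev_frac by blast
      from dv.frac_divide[OF this u] show ?thesis
        using dv.frac_nonzero[OF u] by auto
    next
      case 3
      obtain A' where A': "A = [:- a, 1:] * A'"
        using 3 unfolding poly_eq_0_iff_dvd by (auto elim: dvdE)
      obtain B' where B': "B = [:- a, 1:] * B'"
        using 3 unfolding poly_eq_0_iff_dvd by (auto elim: dvdE)
      \<comment> \<open>One of \<open>A\<close> and \<open>B\<close> may be zero, and its degree
        then stays 0; the sum of the degrees drops because of the other one.\<close>
      have deg: "degree ([:- a, 1:] * C) = (if C = 0 then 0 else degree C + 1)" for C
        using degree_mult_eq[of "[:- a, 1:]" C] by (auto simp del: mult_pCons_left)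
      have "A' \<noteq> 0 \<or> B' \<noteq> 0"
        using less.prems A' B' by auto
      moreover have "degree A' + degree B' < degree A + degree B"
        unfolding A' B' deg using less.prems A' B' by auto
      ultimately obtain n where n: "elt s t A' B' \<in> dv.frac n"
        using less.hyps by blast
      have "elt s t A B = ev s [:- a, 1:] * elt s t A' B'"
        unfolding elt_def A' B' ev_mult by (simp add: algebra_simps)
      then show ?thesis
        using dv.frac_mult[OF ev_linear_frac n] by auto
    qed
  qed
qed

end

section \<open>The hyperelliptic curve\<close>

locale hyperelliptic =
  fixes \<alpha> :: "nat \<Rightarrow> 'a::alg_closed_field" and g :: nat
  assumes char_ne_2: "CHAR('a) \<noteq> 2"
    and distinct_roots: "inj_on \<alpha> {1..2 * g + 1}"
begin

abbreviation f where "f \<equiv> hyp_poly g \<alpha>"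
abbreviation x :: "'a fun_closure" where "x \<equiv> fun_x"
abbreviation y :: "'a fun_closure" where "y \<equiv> fun_y f"
abbreviation z :: "'a fun_closure" where "z \<equiv> 1 / fun_x"
abbreviation w :: "'a fun_closure" where "w \<equiv> fun_y f / fun_x ^ (g + 1)"
text \<open>This is z^(2g+2) f(1/z): reversing \<open>f\<close>, of degree 2g+1, gives z^(2g+1)
  f(1/z).\<close>

abbreviation f_inf where "f_inf \<equiv> [:0, 1:] * reflect_poly f"

lemma two_nonzero: "(2::'a) \<noteq> 0"
proof
  assume "(2::'a) = 0"
  then have "of_nat 2 = (0::'a)"
    by simp
  then have "CHAR('a) dvd 2"
    unfolding of_nat_eq_0_iff_char_dvd .
  then have "CHAR('a) = 1 \<or> CHAR('a) = 2"
    using prime_nat_iff two_is_prime_nat by blast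
  then show False
    using char_ne_2 by simp
qed

lemma f_nonzero: "f \<noteq> 0"
  unfolding hyp_poly_def by (subst prod_zero_iff) auto

lemma poly_f_eq_0_iff: "poly f a = 0 \<longleftrightarrow> a \<in> \<alpha> ` {1..2 * g + 1}"
  unfolding hyp_poly_def poly_prod by (subst prod_zero_iff) auto

lemma degree_f: "degree f = 2 * g + 1"
  unfolding hyp_poly_def by (subst degree_prod_eq_sum_degree) auto

lemma order_f:
  assumes "poly f a = 0"
  shows "order a f = 1"
proof -
  obtain i where i: "i \<in> {1..2 * g + 1}" "a = \<alpha> i"
    using assms unfolding poly_f_eq_0_iff by blast
  let ?h = "\<Prod>j\<in>{1..2 * g + 1} - {i}. [:- \<alpha> j, 1:]"
  have h: "f = [:- a, 1:] * ?h"
    unfolding hyp_poly_def i(2) using i(1) by (subst prod.remove) auto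
  have "poly ?h a \<noteq> 0"
    using i distinct_roots by (auto simp: poly_prod dest: inj_onD)
  then have "order a ?h = 0"
    by (rule order_0I)
  moreover have "order a f = order a [:- a, 1:] + order a ?h"
    using f_nonzero unfolding h by (rule order_mult)
  ultimately show ?thesis
    using order_power_n_n[of a 1] by simp
qed

lemma fun_x_nonzero: "x \<noteq> 0"
  by (simp add: fun_x_def)

lemma double_cover: "double_cover x y f"
proof
  show "\<exists>e. order e f = 1"
    using order_f[of "\<alpha> 1"] unfolding poly_f_eq_0_iff by force
qed (use f_nonzero in \<open>auto simp: ev_fun_x fun_y_squared\<close>)

sublocale cov: double_cover x y f
  by (rule double_cover)

lemma smooth_chart_affine: "b\<^sup>2 = poly f a \<Longrightarrow> smooth_chart x y f a b"
  using two_nonzero order_f by unfold_locales auto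

lemma ev_infinity: "ev z (reflect_poly p) = z ^ degree p * ev x p"
  using ev_reflect_poly[of z p] fun_x_nonzero by simp

text \<open>The constant coefficient of the reversed \<open>f\<close> is the leading coefficient of
  \<open>f\<close>, so \<open>f_inf\<close> has a simple root at 0. Infinity is thus a branch point,
  with uniformizer \<open>w\<close>.\<close>

sublocale inf: smooth_chart z w f_inf 0 0
proof
  fix p :: "'a poly"
  assume "ev z p = 0"
  then have "ev x (reflect_poly p) = 0"
    using ev_reflect_poly[OF fun_x_nonzero] by simp
  then show "p = 0"
    by (simp add: ev_fun_x)
next
  have "(g + 1) * 2 = 2 * g + 2"
    by simp
  then have "(x ^ (g + 1))\<^sup>2 = x ^ (2 * g + 2)"
    by (metis power_mult)
  then have "w\<^sup>2 = ev x f * z ^ (2 * g + 2)"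
    by (simp only: power_divide power_one fun_y_squared ev_fun_x times_divide_eq_right mult_1_right)
  also have "\<dots> = ev z f_inf"
    unfolding ev_mult ev_infinity degree_f by simp
  finally show "w\<^sup>2 = ev z f_inf" .
next
  show "f_inf \<noteq> 0"
    using f_nonzero by simp
  have "order 0 f_inf = order 0 [:0, 1::'a:] + order 0 (reflect_poly f)"
    using \<open>f_inf \<noteq> 0\<close> by (rule order_mult)
  also have "order 0 (reflect_poly f) = 0"
    using f_nonzero by (intro order_0I) simp
  also have "order 0 [:0, 1::'a:] = 1"
    using order_power_n_n[of "0::'a" 1] by simp
  finally show "order 0 f_inf = 1"
    by simp
  then show "\<exists>e. order e f_inf = 1"
    by blast
qed (use two_nonzero in auto)

section \<open>Valuations at the points of the curve\<close>

fun unif :: "'a point \<Rightarrow> 'a fun_closure" where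
  "unif (Affine a b) = smooth_chart.\<pi> x y a b"
| "unif Infinity = smooth_chart.\<pi> z w 0 0"

lemma discrete_valuation_local_ring:
  assumes "P \<in> curve f"
  shows "discrete_valuation (local_ring g f P) (max_ideal g f P) (unif P)"
proof (cases P)
  case (Affine a b)
  then interpret smooth_chart x y f a b
    using assms by (intro smooth_chart_affine) (auto simp: curve_def)
  show ?thesis
    using Affine dv.discrete_valuation_axioms by simp
next
  case Infinity
  then show ?thesis
    using inf.dv.discrete_valuation_axioms by simp
qed

abbreviation frac :: "'a point \<Rightarrow> int \<Rightarrow> 'a fun_closure set" where
  "frac P \<equiv> discrete_valuation.frac (local_ring g f P) (unif P)"

lemma ord_at_eq:
  assumes "P \<in> curve f" "\<phi> \<in> frac P n"
  shows "ord_at g f P \<phi> = n"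
proof -
  have "ord_at g f P \<phi> = valuation (local_ring g f P) (max_ideal g f P) \<phi>"
    by (simp add: ord_at_def valuation_def uniformizer_def)
  then show ?thesis
    using discrete_valuation.valuation_eq[OF discrete_valuation_local_ring] assms by simp
qed

lemma frac_infinity: "frac Infinity = inf.dv.frac"
  unfolding local_ring.simps unif.simps ..

text \<open>A(x) is the reversed polynomial at \<open>z\<close> divided by z^(deg A). The reversed
  polynomial is a unit at infinity, its constant coefficient being the leading coefficient of
  \<open>A\<close>, and \<open>z\<close> has valuation 2.\<close>

lemma ev_frac_infinity:
  assumes "A \<noteq> 0"
  shows "ev x A \<in> frac Infinity (- 2 * int (degree A))"
proof -
  have "z \<in> inf.dv.frac 2"
    using inf.ev_linear_frac by simp
  then have "z ^ degree A \<in> inf.dv.frac (int (degree A) * 2)"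
    by (rule inf.dv.frac_power)
  moreover have "ev z (reflect_poly A) \<in> inf.dv.frac 0"
    using assms by (intro inf.ev_units) simp
  ultimately have "ev z (reflect_poly A) / z ^ degree A \<in> inf.dv.frac (0 - int (degree A) * 2)"
    by (intro inf.dv.frac_divide)
  moreover have "ev z (reflect_poly A) / z ^ degree A = ev x A"
    using fun_x_nonzero by (simp add: ev_infinity)
  moreover have "0 - int (degree A) * 2 = - 2 * int (degree A)"
    by simp
  ultimately show ?thesis
    unfolding frac_infinity by metis
qed

text \<open>From y = w / z^(g+1), where \<open>w\<close> has valuation 1 and \<open>z\<close> has
  valuation 2.\<close>

lemma y_frac_infinity: "y \<in> frac Infinity (- (2 * int g + 1))"
proof -
  have "w \<in> inf.dv.frac 1"
    using inf.dv.pi_frac unfolding inf.pi_cases(1)[OF refl] .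
  moreover have "z \<in> inf.dv.frac 2"
    using inf.ev_linear_frac by simp
  then have "z ^ (g + 1) \<in> inf.dv.frac (int (g + 1) * 2)"
    by (rule inf.dv.frac_power)
  ultimately have "w / z ^ (g + 1) \<in> inf.dv.frac (1 - int (g + 1) * 2)"
    by (rule inf.dv.frac_divide)
  moreover have "w / z ^ (g + 1) = y"
    using fun_x_nonzero by (simp add: power_divide)
  moreover have "1 - int (g + 1) * 2 = - (2 * int g + 1)"
    by simp
  ultimately show ?thesis
    unfolding frac_infinity by metis
qed

lemma elt_frac_infinity:
  assumes "B \<noteq> 0"
  shows "\<exists>n \<le> - (2 * int g + 1). elt x y A B \<in> frac Infinity n"
proof -
  let ?n = "- 2 * int (degree B) + - (2 * int g + 1)"
  have B: "ev x B * y \<in> inf.dv.frac ?n"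
    using ev_frac_infinity[OF assms] y_frac_infinity unfolding frac_infinity
    by (rule inf.dv.frac_mult)
  show ?thesis
  proof (cases "A = 0")
    case True
    then have "elt x y A B \<in> inf.dv.frac ?n"
      using B by (simp only: elt_def ev_0 add_0_left)
    then show ?thesis
      unfolding frac_infinity by (intro exI[of _ ?n] conjI) auto
  next
    case False
    \<comment> \<open>The left side is even and \<open>?n\<close> is odd.\<close>
    have "- 2 * int (degree A) \<noteq> ?n"
      by presburger
    then have "elt x y A B \<in> inf.dv.frac (min (- 2 * int (degree A)) ?n)"
      using ev_frac_infinity[OF False] B unfolding frac_infinity elt_def
      by (intro inf.frac_distinct_add)
    then show ?thesis
      unfolding frac_infinity by (intro exI[of _ "min (- 2 * int (degree A)) ?n"] conjI) auto
  qed
qed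

lemma elt_frac_exists:
  assumes "P \<in> curve f" "A \<noteq> 0 \<or> B \<noteq> 0"
  shows "\<exists>n. elt x y A B \<in> frac P n"
proof (cases P)
  case (Affine a b)
  then interpret smooth_chart x y f a b
    using assms by (intro smooth_chart_affine) (auto simp: curve_def)
  show ?thesis
    using Affine elt_frac assms(2) by simp
next
  case Infinity
  then show ?thesis
    using ev_frac_infinity[of A] elt_frac_infinity[of B A] assms(2) by (cases "B = 0") (auto simp: elt_def)
qed

section \<open>Rational functions in normal form and their orders\<close>

lemma function_field_eq:
  "function_field f = {elt x y A B / elt x y C D | A B C D. elt x y C D \<noteq> 0}"
proof (intro Set.set_eqI iffI)
  fix \<phi> assume "\<phi> \<in> function_field f"
  then obtain p q where pq: "\<phi> = eval2 const p x y / eval2 const q x y" "eval2 const q x y \<noteq> 0"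
    unfolding function_field_def by blast
  obtain A B where "eval2 const p x y = elt x y A B"
    using eval2_reduce[OF cov.t_squared] by metis
  moreover obtain C D where "eval2 const q x y = elt x y C D"
    using eval2_reduce[OF cov.t_squared] by metis
  ultimately show "\<phi> \<in> {elt x y A B / elt x y C D | A B C D. elt x y C D \<noteq> 0}"
    using pq by auto
next
  fix \<phi> assume "\<phi> \<in> {elt x y A B / elt x y C D | A B C D. elt x y C D \<noteq> 0}"
  then show "\<phi> \<in> function_field f"
    unfolding function_field_def by (smt (verit) eval2_elt mem_Collect_eq)
qed

lemma function_fieldE:
  assumes "\<phi> \<in> function_field f"
  obtains A B C D where "\<phi> = elt x y A B / elt x y C D" "elt x y C D \<noteq> 0"
  using assms unfolding function_field_eq by blast

lemma function_fieldI: "elt x y C D \<noteq> 0 \<Longrightarrow> elt x y A B / elt x y C D \<in> function_field f"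
  unfolding function_field_eq by blast

lemma elt_in_function_field: "elt x y A B \<in> function_field f"
  using function_fieldI[of 1 0 A B] by (simp add: elt_def)

lemma function_field_mult:
  assumes "\<phi> \<in> function_field f" "\<psi> \<in> function_field f"
  shows "\<phi> * \<psi> \<in> function_field f"
proof -
  obtain A B C D where "\<phi> = elt x y A B / elt x y C D" "elt x y C D \<noteq> 0"
    using assms(1) by (rule function_fieldE)
  moreover obtain A' B' C' D' where "\<psi> = elt x y A' B' / elt x y C' D'" "elt x y C' D' \<noteq> 0"
    using assms(2) by (rule function_fieldE)
  ultimately have "\<phi> * \<psi> = (elt x y A B * elt x y A' B') / (elt x y C D * elt x y C' D')"
      "elt x y C D * elt x y C' D' \<noteq> 0"
    by auto
  then show ?thesis
    unfolding cov.elt_mult using function_fieldI by simp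
qed

lemma function_field_inverse:
  assumes "\<phi> \<in> function_field f"
  shows "inverse \<phi> \<in> function_field f"
proof (cases "\<phi> = 0")
  case False
  obtain A B C D where "\<phi> = elt x y A B / elt x y C D" "elt x y C D \<noteq> 0"
    using assms by (rule function_fieldE)
  then show ?thesis
    using False function_fieldI by auto
qed (use assms in simp)

text \<open>Shows that the description in \<open>ord_at\<close> has a value for every nonzero
  rational function: numerator and denominator both have a valuation.\<close>

lemma frac_ord_at:
  assumes "P \<in> curve f" "\<phi> \<in> function_field f" "\<phi> \<noteq> 0"
  shows "\<phi> \<in> frac P (ord_at g f P \<phi>)"
proof -
  obtain A B C D where \<phi>: "\<phi> = elt x y A B / elt x y C D" "elt x y C D \<noteq> 0"
    using assms(2) by (rule function_fieldE)
  then have "elt x y A B \<noteq> 0"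
    using assms(3) by auto
  then obtain m n where "elt x y A B \<in> frac P m" "elt x y C D \<in> frac P n"
    using \<phi>(2) elt_frac_exists[OF assms(1)] by (metis cov.elt_eq_0_iff)
  then have "\<phi> \<in> frac P (m - n)"
    unfolding \<phi>(1) by (rule discrete_valuation.frac_divide[OF discrete_valuation_local_ring[OF assms(1)]])
  then show ?thesis
    using ord_at_eq[OF assms(1)] by simp
qed

lemma ord_at_mult:
  assumes "P \<in> curve f" "\<phi> \<in> function_field f - {0}" "\<psi> \<in> function_field f - {0}"
  shows "ord_at g f P (\<phi> * \<psi>) = ord_at g f P \<phi> + ord_at g f P \<psi>"
  using assms by (intro ord_at_eq discrete_valuation.frac_mult[OF discrete_valuation_local_ring] frac_ord_at) auto

lemma ord_at_inverse:
  assumes "P \<in> curve f" "\<phi> \<in> function_field f - {0}"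
  shows "ord_at g f P (inverse \<phi>) = - ord_at g f P \<phi>"
  using assms by (intro ord_at_eq discrete_valuation.frac_inverse[OF discrete_valuation_local_ring] frac_ord_at) auto

section \<open>Functions without poles on the affine curve\<close>

text \<open>Multiplying by the conjugate of the denominator replaces it by its norm, a polynomial in
  \<open>x\<close>.\<close>

lemma clear_denominator:
  assumes "\<phi> \<in> function_field f"
  shows "\<exists>D A B. D \<noteq> 0 \<and> \<phi> * ev x D = elt x y A B"
proof -
  obtain A B C D where \<phi>: "\<phi> = elt x y A B / elt x y C D" "elt x y C D \<noteq> 0"
    using assms by (rule function_fieldE)
  have "C\<^sup>2 - D\<^sup>2 * f \<noteq> 0"
    using \<phi>(2) cov.norm_nonzero cov.elt_eq_0_iff by auto
  moreover have "\<phi> * ev x (C\<^sup>2 - D\<^sup>2 * f) = elt x y A B * elt x y C (- D)"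
    unfolding cov.conjugate[symmetric] using \<phi> by simp
  ultimately show ?thesis
    unfolding cov.elt_mult by blast
qed

text \<open>This makes a denominator of minimal degree constant.  Evaluating \<open>\<phi> D\<close> at \<open>(c, d)\<close> and
  \<open>(c, -d)\<close> gives the claim unless \<open>d = 0\<close>; in that case \<open>x - c\<close> vanishes twice at \<open>(c, 0)\<close> and
  \<open>y\<close> only once.\<close>

lemma common_root:
  assumes poles: "\<And>a b. b\<^sup>2 = poly f a \<Longrightarrow> \<phi> \<in> local_ring g f (Affine a b)"
    and \<phi>: "\<phi> * ev x D = elt x y A B"
    and c: "poly D c = 0"
  shows "poly A c = 0 \<and> poly B c = 0"
proof -
  have vanish: "poly A c + poly B c * d = 0" if d: "d\<^sup>2 = poly f c" for d
  proof -
    interpret smooth_chart x y f c d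
      using d by (rule smooth_chart_affine)
    have "\<phi> \<in> R"
      using poles[OF d] by simp
    \<comment> \<open>As D(c) = 0 and \<phi> is regular at the point, \<phi> D lies in the maximal
      ideal.\<close>
    have "elt x y D 0 \<in> M"
      unfolding elt_M_iff using c by (simp add: val2_def)
    then obtain r where "r \<in> R" "ev x D = \<pi> * r"
      using M_eq_pi by (auto simp: elt_def)
    then have "elt x y A B = \<pi> * (\<phi> * r)" "\<phi> * r \<in> R"
      using \<phi> \<open>\<phi> \<in> R\<close> R_mult by (auto simp: algebra_simps)
    then have "elt x y A B \<in> M"
      using M_eq_pi by blast
    then show ?thesis
      unfolding elt_M_iff by (simp add: val2_def)
  qed
  obtain d where d: "d\<^sup>2 = poly f c"
    using nth_root_exists[of 2 "poly f c"] by auto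
  show ?thesis
  proof (cases "d = 0")
    case False
    have "2 * poly A c = (poly A c + poly B c * d) + (poly A c + poly B c * (- d))"
      by simp
    also have "\<dots> = 0"
      using vanish[OF d] vanish[of "- d"] d by simp
    finally have "poly A c = 0"
      using two_nonzero by simp
    then show ?thesis
      using vanish[OF d] False by simp
  next
    case True
    interpret smooth_chart x y f c d
      using d by (rule smooth_chart_affine)
    have A: "poly A c = 0"
      using vanish[OF d] True by simp
    obtain A' where A': "A = [:- c, 1:] * A'"
      using A unfolding poly_eq_0_iff_dvd by (auto elim: dvdE)
    obtain D' where D': "D = [:- c, 1:] * D'"
      using c unfolding poly_eq_0_iff_dvd by (auto elim: dvdE)
    \<comment> \<open>Chosen so that B y = \<phi> D - A = (x - c) r with \<open>r\<close> regular.
      As x - c is a multiple of the square of y, one factor y can be cancelled and \<open>B\<close>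
      still vanishes at the point.\<close>
    define r where "r = \<phi> * elt x y D' 0 - elt x y A' 0"
    have "\<phi> \<in> R"
      using poles[OF d] by simp
    then have "r \<in> R"
      unfolding r_def diff_conv_add_uminus by (intro R_add R_uminus R_mult elt_R)
    have "ev x [:- c, 1:] \<in> dv.frac 2"
      using ev_linear_frac unfolding if_P[OF True] .
    then obtain u where u: "u \<in> R" "ev x [:- c, 1:] = u * \<pi>\<^sup>2"
      by (auto simp: dv.frac_def dv.units_def)
    have "ev x B * \<pi> = elt x y A B - ev x A"
      unfolding pi_cases(1)[OF True] by (simp add: elt_def)
    also have "\<dots> = \<phi> * ev x D - ev x A"
      using \<phi> by simp
    also have "\<dots> = ev x [:- c, 1:] * r"
      unfolding A' D' ev_mult r_def elt_def by (simp add: algebra_simps)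
    also have "\<dots> = (\<pi> * (u * r)) * \<pi>"
      unfolding u(2) by (simp add: power2_eq_square)
    finally have "elt x y B 0 = \<pi> * (u * r)"
      using pi_nonzero by (simp add: elt_def)
    then have "elt x y B 0 \<in> M"
      using M_eq_pi R_mult[OF u(1) \<open>r \<in> R\<close>] by blast
    then show ?thesis
      unfolding elt_M_iff using A by (simp add: val2_def)
  qed
qed

text \<open>Induction on the degree of the denominator \<open>D\<close>: over an algebraically
  closed field a nonconstant \<open>D\<close> has a root, \<open>A\<close> and \<open>B\<close>
  share it by \<open>common_root\<close>, and the linear factor cancels.\<close>

lemma regular_function:
  assumes "\<phi> \<in> function_field f"
    and poles: "\<And>a b. b\<^sup>2 = poly f a \<Longrightarrow> \<phi> \<in> local_ring g f (Affine a b)"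
  shows "\<exists>A B. \<phi> = elt x y A B"
proof -
  obtain D A B where "D \<noteq> 0" "\<phi> * ev x D = elt x y A B"
    using clear_denominator[OF assms(1)] by blast
  then show ?thesis
  proof (induction "degree D" arbitrary: D A B rule: less_induct)
    case less
    show ?case
    proof (cases "degree D = 0")
      case True
      then obtain c where c: "D = [:c:]"
        by (rule degree_eq_zeroE)
      then have "c \<noteq> 0"
        using less.prems by simp
      then have "const c * const (inverse c) = 1"
        by (simp flip: const_hom(4))
      then have "\<phi> = \<phi> * ev x D * const (inverse c)"
        by (simp add: c)
      also have "\<dots> = elt x y (smult (inverse c) A) (smult (inverse c) B)"
        unfolding less.prems by (simp add: elt_def algebra_simps)
      finally show ?thesis
        by blast
    next
      case False
      then obtain c where c: "poly D c = 0"
        using alg_closed_imp_poly_has_root by blast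
      have "poly A c = 0 \<and> poly B c = 0"
        using poles less.prems(2) c by (rule common_root)
      then obtain A' B' where AB: "A = [:- c, 1:] * A'" "B = [:- c, 1:] * B'"
        unfolding poly_eq_0_iff_dvd by (auto elim!: dvdE)
      obtain D' where D': "D = [:- c, 1:] * D'"
        using c unfolding poly_eq_0_iff_dvd by (auto elim: dvdE)
      have "D' \<noteq> 0"
        using D' less.prems(1) by auto
      have "degree D = degree D' + 1"
        unfolding D' using degree_mult_eq[of "[:- c, 1:]" D'] \<open>D' \<noteq> 0\<close> by (simp del: mult_pCons_left)
      moreover have "ev x [:- c, 1:] \<noteq> 0"
        using cov.ev_eq_0[of "[:- c, 1:]"] by (auto simp del: ev_pCons)
      moreover have "ev x [:- c, 1:] * (\<phi> * ev x D') = ev x [:- c, 1:] * elt x y A' B'"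
        using less.prems(2) unfolding AB D' elt_def ev_mult by (simp add: algebra_simps del: ev_pCons)
      ultimately show ?thesis
        using less.hyps \<open>D' \<noteq> 0\<close> by (metis less_add_one mult_left_cancel)
    qed
  qed
qed

section \<open>The order of a point\<close>

lemma subgroup_principal_divisors: "subgroup (principal_divisors g f) (divisor_group f)"
proof (rule group.subgroupI[OF group_free_Abelian_group])
  show "principal_divisors g f \<subseteq> carrier (divisor_group f)"
    unfolding principal_divisors_def by blast
  have 1: "elt x y 1 0 = 1"
    by (simp add: elt_def)
  \<comment> \<open>Additivity applied to 1 = 1 * 1.\<close>
  have "ord_at g f P 1 = 0" if "P \<in> curve f" for P
    using ord_at_mult[OF that, of 1 1] elt_in_function_field[of 1 0] 1 by simp
  then have "0 \<in> principal_divisors g f"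
    unfolding principal_divisors_def using elt_in_function_field[of 1 0] 1 by force
  then show "principal_divisors g f \<noteq> {}"
    by blast
next
  fix D assume "D \<in> principal_divisors g f"
  then obtain \<phi> where \<phi>: "Poly_Mapping.keys D \<subseteq> curve f" "\<phi> \<in> function_field f - {0}"
      "\<forall>P \<in> curve f. Poly_Mapping.lookup D P = ord_at g f P \<phi>"
    unfolding principal_divisors_def by auto
  then have "- D \<in> principal_divisors g f"
    unfolding principal_divisors_def using function_field_inverse ord_at_inverse
    by (auto intro!: bexI[of _ "inverse \<phi>"])
  then show "inv\<^bsub>divisor_group f\<^esub> D \<in> principal_divisors g f"
    using \<phi>(1) by simp
next
  fix D E assume "D \<in> principal_divisors g f" "E \<in> principal_divisors g f"
  then obtain \<phi> \<psi> where \<phi>: "Poly_Mapping.keys D \<subseteq> curve f" "\<phi> \<in> function_field f - {0}"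
      "\<forall>P \<in> curve f. Poly_Mapping.lookup D P = ord_at g f P \<phi>"
    and \<psi>: "Poly_Mapping.keys E \<subseteq> curve f" "\<psi> \<in> function_field f - {0}"
      "\<forall>P \<in> curve f. Poly_Mapping.lookup E P = ord_at g f P \<psi>"
    unfolding principal_divisors_def by auto
  have "Poly_Mapping.keys (D + E) \<subseteq> curve f"
    using \<phi>(1) \<psi>(1) keys_add[of D E] by blast
  moreover have "\<phi> * \<psi> \<in> function_field f - {0}"
    using \<phi>(2) \<psi>(2) function_field_mult by auto
  moreover have "\<forall>P \<in> curve f. Poly_Mapping.lookup (D + E) P = ord_at g f P (\<phi> * \<psi>)"
    using \<phi> \<psi> ord_at_mult by (simp add: lookup_add)
  ultimately show "D \<otimes>\<^bsub>divisor_group f\<^esub> E \<in> principal_divisors g f"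
    unfolding principal_divisors_def by auto
qed

sublocale prin: normal "principal_divisors g f" "divisor_group f"
  by (rule comm_group.subgroup_imp_normal[OF abelian_free_Abelian_group subgroup_principal_divisors])

lemma group_hom_divisor_class: "group_hom (divisor_group f) (Pic g f) (divisor_class g f)"
  using prin.r_coset_hom_Mod prin.factorgroup_is_group
  by (simp add: group_hom_def group_hom_axioms_def Pic_def divisor_class_def[abs_def])

lemma divisor_degree_add: "divisor_degree (D + E) = divisor_degree D + divisor_degree E"
proof -
  \<comment> \<open>Terms may cancel in \<open>D + E\<close>, so its support can be smaller than the
    union; all three degrees are therefore summed over the union.\<close>
  have *: "divisor_degree C = (\<Sum>P\<in>Poly_Mapping.keys D \<union> Poly_Mapping.keys E. Poly_Mapping.lookup C P)"
    if "Poly_Mapping.keys C \<subseteq> Poly_Mapping.keys D \<union> Poly_Mapping.keys E" for C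
    unfolding divisor_degree_def using that
    by (intro sum.mono_neutral_left) (auto simp: in_keys_iff)
  show ?thesis
    using *[of D] *[of E] *[OF keys_add] by (simp add: lookup_add sum.distrib)
qed

lemma divisor_degree_uminus: "divisor_degree (- D) = - divisor_degree D"
  by (simp add: divisor_degree_def sum_negf)

lemma subgroup_degree_zero:
  "subgroup {D \<in> carrier (divisor_group f). divisor_degree D = 0} (divisor_group f)"
proof (rule group.subgroupI[OF group_free_Abelian_group])
  have "0 \<in> {D \<in> carrier (divisor_group f). divisor_degree D = 0}"
    by (simp add: divisor_degree_def)
  then show "{D \<in> carrier (divisor_group f). divisor_degree D = 0} \<noteq> {}"
    by blast
qed (use keys_add in \<open>force simp: divisor_degree_add divisor_degree_uminus\<close>)+

text \<open>The carrier is the image of the subgroup of divisors of degree zero under the quotient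
  map.\<close>

lemma group_Jacobian: "group (Jacobian g f)"
proof -
  interpret group_hom "divisor_group f" "Pic g f" "divisor_class g f"
    by (rule group_hom_divisor_class)
  show ?thesis
    unfolding Jacobian_def
    by (rule H.subgroup_imp_group) (rule subgroup_img_is_subgroup[OF subgroup_degree_zero])
qed

section \<open>Multiples of the class of a point\<close>

definition point_divisor :: "'a point \<Rightarrow> 'a point \<Rightarrow>\<^sub>0 int" where
  "point_divisor P = Poly_Mapping.single P 1 - Poly_Mapping.single Infinity 1"

lemma keys_point_divisor: "P \<in> curve f \<Longrightarrow> Poly_Mapping.keys (point_divisor P) \<subseteq> curve f"
  using keys_diff[of "Poly_Mapping.single P 1" "Poly_Mapping.single Infinity (1::int)"]
  by (auto simp: point_divisor_def curve_def)

lemma lookup_point_divisor: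
  "Poly_Mapping.lookup (point_divisor P) Q = of_bool (Q = P) - of_bool (Q = Infinity)"
  by (auto simp: point_divisor_def lookup_minus lookup_single when_def)

text \<open>Translates orders into principal divisors. Powers may be computed in \<open>Pic\<close>,
  since the Jacobian differs from it only in the carrier, and a coset is the identity exactly when
  its representative is principal.\<close>

lemma ord_point_class_dvd_iff:
  assumes "P \<in> curve f"
  shows "group.ord (Jacobian g f) (point_class g f P) dvd n
    \<longleftrightarrow> frag_cmul (int n) (point_divisor P) \<in> principal_divisors g f"
proof -
  interpret group_hom "divisor_group f" "Pic g f" "divisor_class g f"
    by (rule group_hom_divisor_class)
  have carr: "point_divisor P \<in> carrier (divisor_group f)"
    using keys_point_divisor[OF assms] by simp
  have "divisor_degree (Poly_Mapping.single Q 1) = 1" for Q :: "'a point"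
    by (simp add: divisor_degree_def)
  then have "divisor_degree (point_divisor P) = 0"
    using divisor_degree_add[of "Poly_Mapping.single P 1" "- Poly_Mapping.single Infinity 1"]
    by (simp add: point_divisor_def divisor_degree_uminus)
  then have "point_class g f P \<in> carrier (Jacobian g f)"
    using carr by (auto simp: Jacobian_def point_class_def point_divisor_def)
  then have "group.ord (Jacobian g f) (point_class g f P) dvd n
      \<longleftrightarrow> point_class g f P [^]\<^bsub>Jacobian g f\<^esub> n = \<one>\<^bsub>Jacobian g f\<^esub>"
    using group.pow_eq_id[OF group_Jacobian] by simp
  also have "\<dots> \<longleftrightarrow> divisor_class g f (point_divisor P) [^]\<^bsub>Pic g f\<^esub> n = \<one>\<^bsub>Pic g f\<^esub>"
    by (simp add: Jacobian_def point_class_def point_divisor_def flip: H.nat_pow_consistent)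
  also have "divisor_class g f (point_divisor P) [^]\<^bsub>Pic g f\<^esub> n
      = divisor_class g f (frag_cmul (int n) (point_divisor P))"
    using hom_nat_pow[OF carr, of n] by simp
  also have "\<dots> = \<one>\<^bsub>Pic g f\<^esub> \<longleftrightarrow> frag_cmul (int n) (point_divisor P) \<in> principal_divisors g f"
  proof -
    have "frag_cmul (int n) (point_divisor P) \<in> carrier (divisor_group f)"
      using keys_point_divisor[OF assms] keys_cmul by fastforce
    then show ?thesis
      unfolding divisor_class_def Pic_def one_FactGroup
      using group.coset_join1[OF group_free_Abelian_group _ _ subgroup_principal_divisors]
        group.coset_join2[OF group_free_Abelian_group _ subgroup_principal_divisors] by blast
  qed
  finally show ?thesis .
qed

lemma ord_infinity: "group.ord (Jacobian g f) (point_class g f Infinity) = 1"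
proof -
  have "point_divisor Infinity = 0"
    by (simp add: point_divisor_def)
  moreover have "0 \<in> principal_divisors g f"
    using subgroup.one_closed[OF subgroup_principal_divisors] by simp
  ultimately show ?thesis
    using ord_point_class_dvd_iff[of Infinity 1] by (simp add: curve_def)
qed

lemma ord_weierstrass_point:
  assumes "Affine a 0 \<in> curve f"
  shows "group.ord (Jacobian g f) (point_class g f (Affine a 0)) dvd 2"
proof -
  let ?\<phi> = "ev x [:- a, 1:]"
  have 0: "?\<phi> \<noteq> 0"
    using cov.ev_eq_0[of "[:- a, 1:]"] by (auto simp del: ev_pCons)
  have F: "?\<phi> \<in> function_field f"
    using elt_in_function_field[of "[:- a, 1:]" 0] by (simp add: elt_def del: ev_pCons)
  have "poly f a = 0"
    using assms by (simp add: curve_def)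
  have "ord_at g f P ?\<phi> = 2 * (of_bool (P = Affine a 0) - of_bool (P = Infinity))"
    if P: "P \<in> curve f" for P
  proof (cases P)
    case (Affine c d)
    then interpret smooth_chart x y f c d
      using P by (intro smooth_chart_affine) (auto simp: curve_def)
    show ?thesis
    proof (cases "c = a")
      case True
      \<comment> \<open>Only one point of the curve lies over a root of \<open>f\<close>; every
        other affine point gives x - a a nonzero value.\<close>
      then have "d = 0"
        using on_curve \<open>poly f a = 0\<close> by simp
      then have "?\<phi> \<in> frac P 2"
        using ev_linear_frac True Affine by (simp del: ev_pCons)
      then show ?thesis
        using ord_at_eq[OF P] Affine True \<open>d = 0\<close> by simp
    next
      case False
      then have "?\<phi> \<in> frac P 0"
        using ev_units[of "[:- a, 1:]"] Affine by (simp del: ev_pCons)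
      then show ?thesis
        using ord_at_eq[OF P] Affine False by simp
    qed
  next
    case Infinity
    then have "?\<phi> \<in> frac P (- 2)"
      using ev_frac_infinity[of "[:- a, 1:]"] by (simp del: ev_pCons)
    then show ?thesis
      using ord_at_eq[OF P] Infinity by simp
  qed
  moreover have "Poly_Mapping.keys (frag_cmul 2 (point_divisor (Affine a 0))) \<subseteq> curve f"
    using keys_point_divisor[OF assms] keys_cmul by blast
  ultimately have "frag_cmul (int 2) (point_divisor (Affine a 0)) \<in> principal_divisors g f"
    unfolding principal_divisors_def using 0 F
    by (auto intro!: bexI[of _ ?\<phi>] simp: lookup_point_divisor simp del: ev_pCons)
  then show ?thesis
    using ord_point_class_dvd_iff[OF assms] by blast
qed

lemma principal_multiple:
  assumes P: "Affine a b \<in> curve f"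
    and "0 < n" "n \<le> 2 * g"
    and "frag_cmul (int n) (point_divisor (Affine a b)) \<in> principal_divisors g f"
  shows "b = 0"
proof (rule ccontr)
  assume "b \<noteq> 0"
  have b: "b\<^sup>2 = poly f a"
    using P by (simp add: curve_def)
  obtain \<phi> where \<phi>: "\<phi> \<in> function_field f" "\<phi> \<noteq> 0"
    and "\<And>Q. Q \<in> curve f \<Longrightarrow>
      Poly_Mapping.lookup (frag_cmul (int n) (point_divisor (Affine a b))) Q = ord_at g f Q \<phi>"
    using assms(4) unfolding principal_divisors_def by auto
  then have frac: "\<phi> \<in> frac Q (int n * (of_bool (Q = Affine a b) - of_bool (Q = Infinity)))"
    if "Q \<in> curve f" for Q
    using frac_ord_at[OF that \<phi>] that by (simp add: lookup_point_divisor)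
  \<comment> \<open>The divisor of \<phi> is n(P - \<infinity>), with nonnegative coefficients at
    all affine points.\<close>
  have "\<phi> \<in> local_ring g f (Affine c d)" if "d\<^sup>2 = poly f c" for c d
  proof -
    have "Affine c d \<in> curve f"
      using that by (simp add: curve_def)
    from discrete_valuation.frac_closed[OF discrete_valuation_local_ring[OF this] frac[OF this]]
    show ?thesis
      by simp
  qed
  then obtain A B where AB: "\<phi> = elt x y A B"
    using regular_function[OF \<phi>(1)] by blast
  have "B = 0"
  proof (rule ccontr)
    assume "B \<noteq> 0"
    then obtain k where k: "k \<le> - (2 * int g + 1)" "\<phi> \<in> frac Infinity k"
      unfolding AB using elt_frac_infinity by blast
    \<comment> \<open>The pole of order \<open>n\<close> at infinity would have order at least 2g+1,
      against \<open>n \<le> 2 * g\<close>.\<close>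
    have "k = - int n"
      using inf.dv.frac_unique[of \<phi> k "- int n"] k(2) frac[of Infinity] by (simp add: curve_def)
    then show False
      using k(1) assms(3) by simp
  qed
  have "poly A a = 0"
  proof -
    interpret smooth_chart x y f a b
      using b by (rule smooth_chart_affine)
    have "\<phi> \<in> dv.frac (int n)"
      using frac[OF P] by simp
    then have "elt x y A 0 \<in> M"
      using dv.frac_pos_iff assms(2) AB \<open>B = 0\<close> by simp
    then show ?thesis
      unfolding elt_M_iff by (simp add: val2_def)
  qed
  \<comment> \<open>At the conjugate point the divisor of \<phi> has coefficient 0, since
    \<open>b\<close> and \<open>- b\<close> differ, and yet \<phi> = A(x) takes the value A(a) = 0
    there.\<close>
  have b': "(- b)\<^sup>2 = poly f a"
    using b by simp
  interpret smooth_chart x y f a "- b"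
    using b' by (rule smooth_chart_affine)
  have "b \<noteq> - b"
    using \<open>b \<noteq> 0\<close> two_nonzero by (simp add: eq_neg_iff_add_eq_0 flip: mult_2)
  then have "\<phi> \<in> dv.frac 0"
    using frac[of "Affine a (- b)"] b' by (simp add: curve_def)
  moreover have "\<phi> \<in> M"
    unfolding AB \<open>B = 0\<close> elt_M_iff using \<open>poly A a = 0\<close> by (simp add: val2_def)
  ultimately show False
    using dv.frac_pos_iff by blast
qed

lemma no_point_of_small_order:
  assumes "P \<in> curve f" and "3 \<le> m" "m \<le> 2 * g"
  shows "group.ord (Jacobian g f) (point_class g f P) \<noteq> m"
proof
  assume m: "group.ord (Jacobian g f) (point_class g f P) = m"
  show False
  proof (cases P)
    case (Affine a b)
    \<comment> \<open>The order \<open>m\<close> divides itself, so m(P - \<infinity>) is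
      principal.\<close>
    have "b = 0"
      using principal_multiple[of a b m] ord_point_class_dvd_iff[OF assms(1), of m] m assms Affine
      by simp
    then have "m dvd 2"
      using ord_weierstrass_point[of a] assms(1) m Affine by simp
    then have "m \<le> 2"
      by (rule dvd_imp_le) simp
    then show False
      using assms(2) by simp
  next
    case Infinity
    then show False
      using ord_infinity m assms(2) by simp
  qed
qed

end

theorem corollary2p8:
  fixes \<alpha> :: "nat \<Rightarrow> 'a::alg_closed_field" and g :: nat
  assumes "CHAR('a) \<noteq> 2"
    and "g > 1"
    and "inj_on \<alpha> {1..2 * g + 1}"
  shows "(\<forall>m::int. 3 \<le> m \<and> m \<le> 2 * int g \<longrightarrow>
            \<not> (\<exists>P \<in> curve (hyp_poly g \<alpha>).
                 int (group.ord (Jacobian g (hyp_poly g \<alpha>))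
                        (point_class g (hyp_poly g \<alpha>) P)) = m)) \<and>
         \<not> (\<exists>P \<in> curve (hyp_poly g \<alpha>).
              group.ord (Jacobian g (hyp_poly g \<alpha>)) (point_class g (hyp_poly g \<alpha>) P) = 3) \<and>
         \<not> (\<exists>P \<in> curve (hyp_poly g \<alpha>).
              group.ord (Jacobian g (hyp_poly g \<alpha>)) (point_class g (hyp_poly g \<alpha>) P) = 4)"
proof -
  interpret hyperelliptic \<alpha> g
    using assms by unfold_locales
  \<comment> \<open>Orders 3 and 4 are instances, because \<open>g > 1\<close> gives 4 \<le>
    2g.\<close>
  show ?thesis
    using no_point_of_small_order assms(2) by fastforce
qed

end
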